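(* Let $n,k$ be positive integers with $k\geq 4$ and $n\geq 3k+1$. Then $$\left\lfloor\frac{(n+k-1)^2}{4}\right\rfloor\leq ex_{ori}(n,\overrightarrow{S_{k,1}})\leq \left\lfloor\frac{(n+k-1)^2}{4}\right\rfloor+(k-1)n.$$
   Context: An oriented graph is a digraph obtained from a finite simple undirected graph by choosing an orientation for each edge (so no loops, and at most one arc between any two vertices). For a digraph $F$, $D$ is $F$-free if it contains no subgraph isomorphic to $F$. The oriented Turán number $ex_{ori}(n,F)$ is the maximum number of arcs in an $F$-free oriented graph on $n$ vertices. For a positive integer $k$, $\overrightarrow{S_{k,1}}$ is the $1$-subdivision of the in-star with $k$ leaves: it has vertices $v$ (the center), $w_1,\dots,w_k$, $z_1,\dots,z_k$, and arcs $z_iw_i$ and $w_iv$ for $i=1,\dots,k$. *)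

theory Defs
  imports Complex_Main "Graph_Theory.Graph_Theory"
begin

(* A pair_digraph is finite, loop-free and has no parallel arcs;
   the extra axiom excludes pairs of opposite arcs. *)
locale oriented_graph = pair_digraph +
  assumes no_opposite_arcs: "(u, v) \<in> parcs G \<Longrightarrow> (v, u) \<notin> parcs G"

definition digraph_free :: "'b pair_pre_digraph \<Rightarrow> 'a pair_pre_digraph \<Rightarrow> bool" where
  "digraph_free F D \<longleftrightarrow>
    \<not> (\<exists>H. subgraph H (with_proj D) \<and> digraph_iso (with_proj F) H)"

(* Taking the vertices in nat is no restriction, since every finite digraph
   is isomorphic to one with vertices in nat. *)
definition ex_ori_arcs :: "nat \<Rightarrow> 'b pair_pre_digraph \<Rightarrow> nat set" where
  "ex_ori_arcs n F = {card (parcs D) | D :: nat pair_pre_digraph.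
     oriented_graph D \<and> card (pverts D) = n \<and> digraph_free F D}"

definition ex_ori :: "nat \<Rightarrow> 'b pair_pre_digraph \<Rightarrow> nat" where
  "ex_ori n F = Max (ex_ori_arcs n F)"

datatype star_vertex = Center | Mid nat | Leaf nat

definition subdivided_in_star :: "nat \<Rightarrow> star_vertex pair_pre_digraph" where
  "subdivided_in_star k =
    \<lparr> pverts = {Center} \<union> Mid ` {1..k} \<union> Leaf ` {1..k},
      parcs = (\<lambda>i. (Leaf i, Mid i)) ` {1..k} \<union> (\<lambda>i. (Mid i, Center)) ` {1..k} \<rparr>"

lemma oriented_graph_subdivided_in_star: "oriented_graph (subdivided_in_star k)"
  by unfold_locales (auto simp: subdivided_in_star_def)

(* The two lemmas below show that Max in ex_ori is taken over a finite
   nonempty set, so that it is a genuine maximum. *)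
lemma finite_ex_ori_arcs: "finite (ex_ori_arcs n F)"
proof -
  have "x \<le> n * n" if x: "x \<in> ex_ori_arcs n F" for x
  proof -
    obtain D :: "nat pair_pre_digraph" where D: "oriented_graph D"
      "card (pverts D) = n" "x = card (parcs D)"
      using x unfolding ex_ori_arcs_def by blast
    interpret oriented_graph D by (rule D(1))
    have "parcs D \<subseteq> pverts D \<times> pverts D"
      by (auto intro: in_arcsD1 in_arcsD2)
    then have "card (parcs D) \<le> card (pverts D \<times> pverts D)"
      by (intro card_mono finite_cartesian_product pair_finite_verts)
    with D show ?thesis by (simp add: card_cartesian_product)
  qed
  then show ?thesis
    by (meson finite_atMost finite_subset atMost_iff subsetI)
qed

lemma ex_ori_arcs_nonempty:
  assumes "parcs F \<noteq> {}"
  shows "ex_ori_arcs n F \<noteq> {}"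
proof -
  define D :: "nat pair_pre_digraph" where "D = \<lparr> pverts = {..<n}, parcs = {} \<rparr>"
  have "oriented_graph D" by unfold_locales (auto simp: D_def)
  moreover have "card (pverts D) = n" by (simp add: D_def)
  moreover have "digraph_free F D"
    using assms
    by (auto simp: digraph_free_def digraph_iso_def subgraph_def arcs_app_iso D_def)
  ultimately show ?thesis unfolding ex_ori_arcs_def by blast
qed

end

theory Submission
  imports Defs
begin

text \<open>
  Put $m = k - 1$. For the lower bound, orient all edges between two sides $A$ and $B$ towards
  $B$ and add inside $B$ a circulant oriented graph of in-degree $m$. Every vertex that has an
  in-neighbour lies in $B$, so a centre has at most $m$ usable in-neighbours, and there are
  $(|A| + m) |B|$ arcs; balance the two factors.

  For the upper bound, call a vertex large if its in-degree exceeds $2m$. If $k$ large vertices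
  had a common out-neighbour, their private in-neighbours could be chosen greedily. So with $b$
  large and $a$ small vertices there are at most
  $(a + m) b + 2 m a = (a + m)(b + 2 m) - 2 m^2$ arcs, and since the two factors sum to
  $n + 3 m$, this is at most $(n + m)^2 / 4 + m n$.
\<close>

section \<open>In-neighbourhoods, and copies of a digraph as embeddings\<close>

definition in_nbrs :: "'a pair_pre_digraph \<Rightarrow> 'a \<Rightarrow> 'a set" where
  "in_nbrs D v = {u. (u, v) \<in> parcs D}"

lemma (in pair_fin_digraph) in_nbrs_subset: "in_nbrs G v \<subseteq> pverts G"
  by (auto simp: in_nbrs_def intro: in_arcsD1)

lemma (in pair_fin_digraph) finite_in_nbrs: "finite (in_nbrs G v)"
  using in_nbrs_subset pair_finite_verts by (rule finite_subset)

lemma (in pair_fin_digraph) card_parcs_eq_sum_in_nbrs: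
  "card (parcs G) = (\<Sum>v\<in>pverts G. card (in_nbrs G v))"
proof -
  \<comment> \<open>Reversal puts the head first, so the in-neighbourhoods become the fibres of a
    \<open>Sigma\<close>.\<close>
  have "(parcs G)\<inverse> = Sigma (pverts G) (in_nbrs G)"
    by (auto simp: in_nbrs_def intro: in_arcsD2)
  then have "card ((parcs G)\<inverse>) = (\<Sum>v\<in>pverts G. card (in_nbrs G v))"
    by (simp add: card_SigmaI pair_finite_verts finite_in_nbrs)
  then show ?thesis by simp
qed

text \<open>Reduces the search for a subgraph with its isomorphism to a search for an injective
  vertex map: an arc is the pair of its ends, so the vertex map alone determines the copy.\<close>

lemma digraph_free_iff_no_embedding:
  assumes F: "pair_wf_digraph F" and D: "pair_wf_digraph D"
  shows "digraph_free F D \<longleftrightarrow>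
    \<not> (\<exists>f. inj_on f (pverts F) \<and> f ` pverts F \<subseteq> pverts D \<and>
          (\<forall>(u, v)\<in>parcs F. (f u, f v) \<in> parcs D))"
proof -
  have "\<exists>f. inj_on f (pverts F) \<and> f ` pverts F \<subseteq> pverts D \<and>
          (\<forall>(u, v)\<in>parcs F. (f u, f v) \<in> parcs D)"
    if H: "subgraph H (with_proj D)" "digraph_iso (with_proj F) H" for H
  proof -
    obtain h where h: "pre_digraph.digraph_isomorphism (with_proj F) h"
      "H = app_iso h (with_proj F)"
      using H(2) unfolding digraph_iso_def by blast
    \<comment> \<open>Compatibility with \<open>with_proj D\<close> forces tail and head in
      \<open>H\<close> to be the projections; this ties the arc map of \<open>h\<close> to its
      vertex map.\<close>
    have proj: "iso_tail h = fst" "iso_head h = snd"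
      using H(1) h(2) by (auto simp: subgraph_def compatible_def)
    have "(iso_verts h u, iso_verts h v) \<in> parcs D" if uv: "(u, v) \<in> parcs F" for u v
    proof -
      have "iso_arcs h (u, v) = (iso_verts h u, iso_verts h v)"
        using h(1) uv by (auto simp: pre_digraph.digraph_isomorphism_def proj prod_eq_iff)
      moreover have "iso_arcs h (u, v) \<in> parcs D"
        using H(1) h(2) uv by (auto simp: subgraph_def)
      ultimately show ?thesis by simp
    qed
    then show ?thesis
      using H(1) h by (intro exI[of _ "iso_verts h"])
        (auto simp: subgraph_def pre_digraph.digraph_isomorphism_def)
  qed
  moreover have "\<exists>H. subgraph H (with_proj D) \<and> digraph_iso (with_proj F) H"
    if f: "inj_on f (pverts F)" "f ` pverts F \<subseteq> pverts D"
      "\<forall>(u, v)\<in>parcs F. (f u, f v) \<in> parcs D" for f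
  proof -
    interpret F: pair_wf_digraph F by (rule F)
    define h where "h = \<lparr> iso_verts = f, iso_arcs = map_prod f f,
      iso_head = snd, iso_tail = fst \<rparr>"
    have "parcs F \<subseteq> pverts F \<times> pverts F"
      by (auto intro: F.in_arcsD1 F.in_arcsD2)
    then have "inj_on (map_prod f f) (parcs F)"
      using map_prod_inj_on[OF f(1) f(1)] inj_on_subset by blast
    then have "pre_digraph.digraph_isomorphism (with_proj F) h"
      using f(1) F by (simp add: pre_digraph.digraph_isomorphism_def h_def wf_digraph_wp_iff)
    moreover have "wf_digraph (app_iso h (with_proj F))"
      by unfold_locales (auto simp: h_def intro: F.in_arcsD1 F.in_arcsD2)
    then have "subgraph (app_iso h (with_proj F)) (with_proj D)"
      using f(2,3) D
      by (auto simp: subgraph_def compatible_def h_def wf_digraph_wp_iff)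
    ultimately show ?thesis unfolding digraph_iso_def by blast
  qed
  ultimately have "(\<exists>H. subgraph H (with_proj D) \<and> digraph_iso (with_proj F) H) \<longleftrightarrow>
      (\<exists>f. inj_on f (pverts F) \<and> f ` pverts F \<subseteq> pverts D \<and>
        (\<forall>(u, v)\<in>parcs F. (f u, f v) \<in> parcs D))"
    by (intro iffI; elim exE conjE) simp_all
  then show ?thesis by (simp only: digraph_free_def)
qed

section \<open>Greedy choice of leaves, arc bound, and a criterion for freeness\<close>

lemma greedy_system_of_distinct_representatives:
  assumes "finite W" and "\<And>w. w \<in> W \<Longrightarrow> card W \<le> card (N w)"
  shows "\<exists>z. inj_on z W \<and> (\<forall>w\<in>W. z w \<in> N w)"
  using assms
proof (induction W)
  case empty
  then show ?case by simp
next
  case (insert x W)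
  have "\<And>w. w \<in> W \<Longrightarrow> card W \<le> card (N w)"
    using insert.prems insert.hyps by fastforce
  then obtain z where z: "inj_on z W" "\<forall>w\<in>W. z w \<in> N w"
    using insert.IH by blast
  \<comment> \<open>The earlier choices block at most \<open>card W\<close> elements, while
    \<open>N x\<close> has at least one more.\<close>
  have "card (z ` W) < card (N x)"
    using insert.prems[of x] insert.hyps card_image_le[of W z] by simp
  then have "\<not> N x \<subseteq> z ` W"
    using insert.hyps(1) by (meson card_mono finite_imageI leD)
  then obtain y where "y \<in> N x" "y \<notin> z ` W" by blast
  then show ?case
    using z insert.hyps by (intro exI[of _ "z(x := y)"]) (auto simp: inj_on_def)
qed

context oriented_graph
begin

lemma not_free_subdivided_in_starI:
  assumes v: "v \<in> pverts G" and W: "W \<subseteq> in_nbrs G v" "card W = k" "finite W"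
    and z: "inj_on z W" "\<And>w. w \<in> W \<Longrightarrow> z w \<in> in_nbrs G w - W"
  shows "\<not> digraph_free (subdivided_in_star k) G"
proof -
  obtain g where "bij_betw g {1..k} W"
    using W(2,3) by (metis card_atLeastAtMost diff_Suc_1 finite_atLeastAtMost finite_same_card_bij)
  then have g: "inj_on g {1..k}" "g ` {1..k} = W" by (auto simp: bij_betw_def)
  have gW: "g i \<in> W" if "i \<in> {1..k}" for i using g(2) that by blast
  have arcs: "(g i, v) \<in> parcs G" "(z (g i), g i) \<in> parcs G" "z (g i) \<notin> W"
    if "i \<in> {1..k}" for i
    using gW[OF that] W(1) z(2) by (auto simp: in_nbrs_def)
  have ne: "g i \<noteq> v" "z (g i) \<noteq> v" if "i \<in> {1..k}" for i
    using arcs[OF that] no_opposite_arcs by blast+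
  define f where "f x = (case x of Center \<Rightarrow> v | Mid i \<Rightarrow> g i | Leaf i \<Rightarrow> z (g i))" for x
  interpret S: oriented_graph "subdivided_in_star k"
    by (rule oriented_graph_subdivided_in_star)
  have f_arcs: "\<forall>(x, y)\<in>parcs (subdivided_in_star k). (f x, f y) \<in> parcs G"
    using arcs by (auto simp: subdivided_in_star_def f_def)
  have zg: "z (g i) \<noteq> g j" if "i \<in> {1..k}" "j \<in> {1..k}" for i j
    using arcs(3)[OF that(1)] gW[OF that(2)] by auto
  have "inj_on f (pverts (subdivided_in_star k))"
  proof (rule inj_onI)
    fix x y
    assume "x \<in> pverts (subdivided_in_star k)" "y \<in> pverts (subdivided_in_star k)" "f x = f y"
    then show "x = y"
      by (cases x; cases y)
        (auto simp: subdivided_in_star_def f_def ne ne[symmetric] zg zg[symmetric] gW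
          inj_on_eq_iff[OF g(1)] inj_on_eq_iff[OF z(1)])
  qed
  moreover have "f ` pverts (subdivided_in_star k) \<subseteq> pverts G"
    using v arcs(1,2)[THEN in_arcsD1] by (auto simp: subdivided_in_star_def f_def)
  ultimately show ?thesis
    using f_arcs digraph_free_iff_no_embedding[OF S.pair_wf_digraph_axioms pair_wf_digraph_axioms]
    by blast
qed

text \<open>The threshold is in-degree at least 2k - 1, written without subtraction. Since
  \<open>w\<close> is not its own in-neighbour, deleting \<open>W\<close> costs at most k - 1
  in-neighbours and leaves k for the greedy choice.\<close>

lemma card_large_in_nbrs_less:
  assumes free: "digraph_free (subdivided_in_star k) G" and v: "v \<in> pverts G"
  shows "card {w \<in> in_nbrs G v. 2 * k \<le> card (in_nbrs G w) + 1} < k"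
proof (rule ccontr)
  let ?L = "{w \<in> in_nbrs G v. 2 * k \<le> card (in_nbrs G w) + 1}"
  assume "\<not> card ?L < k"
  then obtain W where W: "W \<subseteq> ?L" "card W = k" "finite W"
    by (meson not_less obtain_subset_with_card_n)
  have "card W \<le> card (in_nbrs G w - W)" if w: "w \<in> W" for w
  proof -
    have "w \<notin> in_nbrs G w"
      using no_opposite_arcs by (auto simp: in_nbrs_def)
    then have "in_nbrs G w - W = in_nbrs G w - (W - {w})" by blast
    then have "card (in_nbrs G w - W) = card (in_nbrs G w - (W - {w}))" by simp
    moreover have "card (in_nbrs G w) - card (W - {w}) \<le> card (in_nbrs G w - (W - {w}))"
      using W(3) by (intro diff_card_le_card_Diff) simp
    moreover have "card (W - {w}) = k - 1" "2 * k \<le> card (in_nbrs G w) + 1" "0 < k"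
      using W w by (auto simp: card_gt_0_iff)
    ultimately show ?thesis using W(2) by linarith
  qed
  then obtain z where "inj_on z W" "\<forall>w\<in>W. z w \<in> in_nbrs G w - W"
    using greedy_system_of_distinct_representatives[OF W(3), of "\<lambda>w. in_nbrs G w - W"] by blast
  then show False
    using not_free_subdivided_in_starI[of v W k z] v W free by blast
qed

lemma card_parcs_le_of_free:
  assumes free: "digraph_free (subdivided_in_star (Suc m)) G"
  obtains a b where "a + b = card (pverts G)" "card (parcs G) \<le> (a + m) * b + 2 * m * a"
proof
  define L where "L = {v \<in> pverts G. 2 * m < card (in_nbrs G v)}"
  define S where "S = pverts G - L"
  have fin: "finite L" "finite S" and un: "pverts G = S \<union> L" "S \<inter> L = {}"
    using pair_finite_verts by (auto simp: L_def S_def)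
  show "card S + card L = card (pverts G)"
    using fin un by (simp add: card_Un_disjoint)
  have L_bound: "card (in_nbrs G v) \<le> card S + m" if v: "v \<in> L" for v
  proof -
    let ?W = "{w \<in> in_nbrs G v. 2 * Suc m \<le> card (in_nbrs G w) + 1}"
    \<comment> \<open>For k = m + 1 the condition in \<open>?W\<close> reads
      \<open>2 * m < card (in_nbrs G w)\<close>, the one defining \<open>L\<close>.\<close>
    have "in_nbrs G v \<subseteq> S \<union> ?W"
      using in_nbrs_subset by (force simp: S_def L_def)
    then have "card (in_nbrs G v) \<le> card (S \<union> ?W)"
      using fin finite_in_nbrs by (intro card_mono) auto
    also have "\<dots> \<le> card S + card ?W" by (rule card_Un_le)
    also have "card ?W \<le> m"
      using card_large_in_nbrs_less[OF free, of v] v by (simp add: L_def)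
    finally show ?thesis by simp
  qed
  have "card (parcs G) = (\<Sum>v\<in>S. card (in_nbrs G v)) + (\<Sum>v\<in>L. card (in_nbrs G v))"
    using fin un by (simp add: card_parcs_eq_sum_in_nbrs sum.union_disjoint)
  also have "(\<Sum>v\<in>S. card (in_nbrs G v)) \<le> card S * (2 * m)"
    using sum_bounded_above[of S "\<lambda>v. card (in_nbrs G v)" "2 * m"] by (force simp: S_def L_def)
  also have "(\<Sum>v\<in>L. card (in_nbrs G v)) \<le> card L * (card S + m)"
    using sum_bounded_above[of L "\<lambda>v. card (in_nbrs G v)" "card S + m"] L_bound by simp
  finally show "card (parcs G) \<le> (card S + m) * card L + 2 * m * card S"
    by (simp add: algebra_simps)
qed

text \<open>The middle vertices of a copy are k distinct in-neighbours of its centre, and each has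
  its leaf as an in-neighbour.\<close>

lemma free_subdivided_in_starI:
  assumes "\<And>v. card {w \<in> in_nbrs G v. in_nbrs G w \<noteq> {}} < k"
  shows "digraph_free (subdivided_in_star k) G"
proof (rule ccontr)
  interpret S: oriented_graph "subdivided_in_star k"
    by (rule oriented_graph_subdivided_in_star)
  assume "\<not> digraph_free (subdivided_in_star k) G"
  then obtain f where f: "inj_on f (pverts (subdivided_in_star k))"
    "\<forall>(x, y)\<in>parcs (subdivided_in_star k). (f x, f y) \<in> parcs G"
    using digraph_free_iff_no_embedding[OF S.pair_wf_digraph_axioms pair_wf_digraph_axioms]
    by blast
  let ?W = "{w \<in> in_nbrs G (f Center). in_nbrs G w \<noteq> {}}"
  have "(\<lambda>i. f (Mid i)) ` {1..k} \<subseteq> ?W"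
  proof
    fix w assume "w \<in> (\<lambda>i. f (Mid i)) ` {1..k}"
    then obtain i where "i \<in> {1..k}" "w = f (Mid i)" by blast
    moreover from this have "(f (Mid i), f Center) \<in> parcs G" "(f (Leaf i), f (Mid i)) \<in> parcs G"
      using f(2) by (auto simp: subdivided_in_star_def)
    ultimately show "w \<in> ?W" by (auto simp: in_nbrs_def)
  qed
  then have "card ((\<lambda>i. f (Mid i)) ` {1..k}) \<le> card ?W"
    using finite_in_nbrs by (intro card_mono) auto
  moreover have "inj_on (\<lambda>i. f (Mid i)) {1..k}"
    using f(1) by (auto simp: inj_on_def subdivided_in_star_def)
  ultimately show False
    using assms[of "f Center"] by (simp add: card_image)
qed

end

section \<open>Circulant construction for the lower bound\<close>

definition cyc_pred :: "nat \<Rightarrow> nat \<Rightarrow> nat \<Rightarrow> nat" where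
  "cyc_pred b v j = (if j \<le> v then v - j else v + b - j)"

text \<open>The side B is the initial segment \<open>{..<b}\<close>, so its vertices are the
  residues modulo b, and \<open>cyc_pred b v j\<close> is v - j modulo b. The side A is
  \<open>{b..<n}\<close>.\<close>

definition lower_digraph :: "nat \<Rightarrow> nat \<Rightarrow> nat \<Rightarrow> nat pair_pre_digraph" where
  "lower_digraph n b m = \<lparr> pverts = {..<n},
     parcs = {(u, v). v < b \<and> u \<in> {b..<n} \<union> cyc_pred b v ` {1..m}} \<rparr>"

lemma in_nbrs_lower_digraph:
  "in_nbrs (lower_digraph n b m) v =
    (if v < b then {b..<n} \<union> cyc_pred b v ` {1..m} else {})"
  by (auto simp: in_nbrs_def lower_digraph_def)

lemma cyc_pred_less: "v < b \<Longrightarrow> j \<in> {1..m} \<Longrightarrow> cyc_pred b v j < b"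
  by (auto simp: cyc_pred_def)

lemma oriented_graph_lower_digraph:
  assumes "b \<le> n" "2 * m < b"
  shows "oriented_graph (lower_digraph n b m)"
proof -
  have "parcs (lower_digraph n b m) \<subseteq> {..<n} \<times> {..<n}"
    using assms(1) by (auto simp: lower_digraph_def dest: cyc_pred_less)
  then have fin: "finite (parcs (lower_digraph n b m))"
    and sub: "\<And>e. e \<in> parcs (lower_digraph n b m) \<Longrightarrow> fst e < n \<and> snd e < n"
    using finite_subset by fastforce+
  \<comment> \<open>Both ends of a pair of opposite arcs would lie in B, with cyclic steps i and j
    such that b divides i + j; but 0 < i + j \<le> 2m < b.\<close>
  have opp: "(v, u) \<notin> parcs (lower_digraph n b m)"
    if "(u, v) \<in> parcs (lower_digraph n b m)" for u v
    using that assms by (auto simp: lower_digraph_def cyc_pred_def split: if_splits)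
  show ?thesis
  proof
    \<comment> \<open>A loop would be its own opposite arc.\<close>
    show "fst e \<noteq> snd e" if "e \<in> parcs (lower_digraph n b m)" for e
      using that opp by (metis prod.collapse)
    show "(v, u) \<notin> parcs (lower_digraph n b m)"
      if "(u, v) \<in> parcs (lower_digraph n b m)" for u v
      using that by (rule opp)
  qed (use fin sub in \<open>auto simp: lower_digraph_def\<close>)
qed

lemma card_cyc_pred_image: "m < b \<Longrightarrow> v < b \<Longrightarrow> card (cyc_pred b v ` {1..m}) = m"
  by (subst card_image) (auto simp: inj_on_def cyc_pred_def split: if_splits)

lemma card_parcs_lower_digraph:
  assumes "b \<le> n" "2 * m < b"
  shows "card (parcs (lower_digraph n b m)) = b * (n - b + m)"
proof -
  interpret oriented_graph "lower_digraph n b m"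
    using assms by (rule oriented_graph_lower_digraph)
  have "card (in_nbrs (lower_digraph n b m) v) = (if v < b then n - b + m else 0)" for v
  proof -
    have "{b..<n} \<inter> cyc_pred b v ` {1..m} = {}" if "v < b"
      using cyc_pred_less[OF that] by fastforce
    then show ?thesis
      using assms by (simp add: in_nbrs_lower_digraph card_Un_disjoint card_cyc_pred_image
          del: One_nat_def)
  qed
  then have "card (parcs (lower_digraph n b m)) = (\<Sum>v<n. if v < b then n - b + m else 0)"
    by (simp add: card_parcs_eq_sum_in_nbrs) (simp add: lower_digraph_def)
  also have "\<dots> = (\<Sum>v<b. n - b + m)"
    using assms(1) by (intro sum.mono_neutral_cong_right) auto
  finally show ?thesis by simp
qed

lemma lower_digraph_free:
  assumes "b \<le> n" "2 * m < b"
  shows "digraph_free (subdivided_in_star (Suc m)) (lower_digraph n b m)"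
proof -
  interpret oriented_graph "lower_digraph n b m"
    using assms by (rule oriented_graph_lower_digraph)
  have "card {w \<in> in_nbrs (lower_digraph n b m) v. in_nbrs (lower_digraph n b m) w \<noteq> {}} \<le> m" for v
  proof -
    have "{w \<in> in_nbrs (lower_digraph n b m) v. in_nbrs (lower_digraph n b m) w \<noteq> {}}
        \<subseteq> cyc_pred b v ` {1..m}"
      by (auto simp: in_nbrs_lower_digraph split: if_splits)
    then have "card {w \<in> in_nbrs (lower_digraph n b m) v. in_nbrs (lower_digraph n b m) w \<noteq> {}}
        \<le> card (cyc_pred b v ` {1..m})"
      by (rule card_mono[rotated]) simp
    also have "\<dots> \<le> m"
      using card_image_le[of "{1..m}" "cyc_pred b v"] by simp
    finally show ?thesis .
  qed
  then show ?thesis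
    by (intro free_subdivided_in_starI) (simp add: less_Suc_eq_le)
qed

section \<open>Balancing the factors and the final bounds\<close>

lemma half_mult_complement: "s div 2 * (s - s div 2) = s\<^sup>2 div (4 :: nat)"
proof (cases "even s")
  case True
  then obtain t where "s = 2 * t" by blast
  then show ?thesis by (simp add: power2_eq_square)
next
  case False
  then obtain t where s: "s = 2 * t + 1" by (rule oddE)
  have "s\<^sup>2 = 4 * (t * (t + 1)) + 1" by (simp add: s power2_eq_square algebra_simps)
  then have "s\<^sup>2 div 4 = t * (t + 1)" by simp
  moreover have "s div 2 = t" "s - s div 2 = t + 1" using s by auto
  ultimately show ?thesis by simp
qed

lemma lower_bound_ex_ori:
  assumes "3 * m + 2 \<le> n"
  shows "(n + m)\<^sup>2 div 4 \<le> ex_ori n (subdivided_in_star (Suc m))"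
proof -
  \<comment> \<open>This choice makes \<open>b\<close> and \<open>n - b + m\<close> the two halves
    of n + m. The assumption says n + m \<ge> 2(2m + 1), which is what \<open>2 * m < b\<close>
    requires.\<close>
  define b where "b = (n + m) div 2"
  have b: "b \<le> n" "2 * m < b" using assms by (auto simp: b_def)
  have "card (parcs (lower_digraph n b m)) = (n + m)\<^sup>2 div 4"
    using card_parcs_lower_digraph[OF b] b(1) half_mult_complement[of "n + m"]
    by (simp add: b_def)
  moreover have "card (pverts (lower_digraph n b m)) = n" by (simp add: lower_digraph_def)
  ultimately have "(n + m)\<^sup>2 div 4 \<in> ex_ori_arcs n (subdivided_in_star (Suc m))"
    using oriented_graph_lower_digraph[OF b] lower_digraph_free[OF b]
    unfolding ex_ori_arcs_def by force
  then show ?thesis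
    unfolding ex_ori_def by (intro Max_ge finite_ex_ori_arcs)
qed

lemma upper_bound_ex_ori:
  "ex_ori n (subdivided_in_star (Suc m)) \<le> (n + m)\<^sup>2 div 4 + m * n"
proof -
  have "card (parcs D) \<le> (n + m)\<^sup>2 div 4 + m * n"
    if D: "oriented_graph D" "card (pverts D) = n" "digraph_free (subdivided_in_star (Suc m)) D"
    for D :: "nat pair_pre_digraph"
  proof -
    obtain a b where ab: "a + b = n" "card (parcs D) \<le> (a + m) * b + 2 * m * a"
      using oriented_graph.card_parcs_le_of_free[OF D(1,3)] D(2) by metis
    \<comment> \<open>This is the square of the difference of the factors a + m and b + 2m, and it
      equals the right side minus the left side of the next inequality. The integers allow a
      negative difference.\<close>
    have "0 \<le> (int a - int b - int m)\<^sup>2" by simp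
    then have "4 * ((int a + int m) * int b + 2 * int m * int a)
        \<le> (int a + int b + int m)\<^sup>2 + 4 * (int m * (int a + int b))"
      by (simp add: power2_eq_square algebra_simps)
    then have "int (4 * ((a + m) * b + 2 * m * a)) \<le> int ((a + b + m)\<^sup>2 + 4 * (m * (a + b)))"
      by simp
    then have "4 * ((a + m) * b + 2 * m * a) \<le> (n + m)\<^sup>2 + 4 * (m * n)"
      unfolding ab(1)[symmetric] of_nat_le_iff .
    \<comment> \<open>As \<open>z\<close> is an integer, rounding down affects only
      \<open>y\<close>.\<close>
    moreover have "x \<le> y div 4 + z" if "4 * x \<le> y + 4 * z" for x y z :: nat
      using that by linarith
    ultimately show ?thesis using ab(2) le_trans by blast
  qed
  \<comment> \<open>With at least one leaf the star has an arc, so the arcless digraph is free of it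
    and \<open>Max\<close> is a genuine maximum.\<close>
  moreover have "ex_ori_arcs n (subdivided_in_star (Suc m)) \<noteq> {}"
    by (rule ex_ori_arcs_nonempty) (simp add: subdivided_in_star_def)
  ultimately show ?thesis
    unfolding ex_ori_def
    by (subst Max_le_iff[OF finite_ex_ori_arcs]) (auto simp: ex_ori_arcs_def)
qed

theorem theorem1p3:
  fixes n k :: nat
  assumes "n > 0" and "k > 0" and "k \<ge> 4" and "n \<ge> 3 * k + 1"
  shows "\<lfloor>(real n + real k - 1)\<^sup>2 / 4\<rfloor> \<le> int (ex_ori n (subdivided_in_star k)) \<and>
         int (ex_ori n (subdivided_in_star k)) \<le> \<lfloor>(real n + real k - 1)\<^sup>2 / 4\<rfloor> + (int k - 1) * int n"
proof -
  obtain m where k: "k = Suc m" using assms(2) gr0_implies_Suc by blast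
  have "(real n + real k - 1)\<^sup>2 / 4 = real ((n + m)\<^sup>2) / real 4" by (simp add: k)
  \<comment> \<open>The floor of a real quotient of naturals is their \<open>div\<close>, so the
    rest is arithmetic in whole numbers.\<close>
  then have floor: "\<lfloor>(real n + real k - 1)\<^sup>2 / 4\<rfloor> = int ((n + m)\<^sup>2 div 4)"
    by (simp only: floor_divide_of_nat_eq)
  have "int (ex_ori n (subdivided_in_star k)) \<le> int ((n + m)\<^sup>2 div 4 + m * n)"
    using upper_bound_ex_ori[of n m] unfolding k of_nat_le_iff .
  moreover have "int ((n + m)\<^sup>2 div 4) \<le> int (ex_ori n (subdivided_in_star k))"
    using lower_bound_ex_ori[of m n] assms(4) unfolding k of_nat_le_iff by simp
  moreover have "int ((n + m)\<^sup>2 div 4 + m * n) = int ((n + m)\<^sup>2 div 4) + (int k - 1) * int n"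
    by (simp add: k)
  ultimately show ?thesis unfolding floor by linarith
qed

end
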